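(* Let $\Gamma=(V,E)$ be a finite connected simple graph on $n$ vertices without isolated vertices, equipped with an arbitrary fixed orientation of its edges, and let $\lambda_n$ be the largest eigenvalue of its normalized Laplace operator $L=\mathrm{Id}-D^{-1}A$. Let $$Q:=\max_{v\sim w}\left(\frac{1}{\deg v}+\frac{1}{\deg w}\right),\qquad \tau:=\max_{v\sim w:\ \deg w\geq \deg v}\frac{(\deg w-\deg v+n)\cdot \deg v}{\deg v+\deg w}.$$ Then $$Q=\max_{\gamma:E\rightarrow\mathbb{R},\ \gamma\neq 0}\ \frac{\sum_{v\in V}\frac{1}{\deg v}\cdot \left|\sum_{e_{\mathrm{in}}:\ v\text{ input of }e_{\mathrm{in}}}\gamma(e_{\mathrm{in}})-\sum_{e_{\mathrm{out}}:\ v\text{ output of }e_{\mathrm{out}}}\gamma(e_{\mathrm{out}})\right|}{\sum_{e\in E}|\gamma(e)|}$$ and $$Q\leq \lambda_n\leq Q\cdot\tau.$$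
   Context: Graphs are finite, undirected, unweighted, without loops, multiple edges or isolated vertices, and connected. The notation $v\sim w$ means that $v$ and $w$ are joined by an edge; the maximum defining $\tau$ is over all edges, with endpoints named so that $\deg w\ge\deg v$ (both namings being allowed if the degrees are equal). An orientation of $\Gamma$ is an arbitrary choice, for each edge, of an ordering $(v,w)$ of its two endpoints; then $v$ is called the input and $w$ the output of the edge. $A$ is the adjacency matrix of $\Gamma$, $D$ the diagonal matrix of vertex degrees, $\mathrm{Id}$ the $n\times n$ identity matrix. The matrix $L=\mathrm{Id}-D^{-1}A$ has real eigenvalues $\lambda_1\le\dots\le\lambda_n$ (counted with multiplicity). *)

theory Defs
  imports "HOL-Analysis.Analysis"
begin

text \<open>
  The vertex set of a graph is the whole of a finite type \<open>'v\<close>, and its edge set is a set \<open>E\<close> of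
  two-element sets of vertices. Loops and multiple edges are thereby excluded.
\<close>

definition adj_rel :: "'v set set \<Rightarrow> ('v \<times> 'v) set" where
  "adj_rel E = {(v, w). {v, w} \<in> E}"

definition degree :: "'v set set \<Rightarrow> 'v \<Rightarrow> nat" where
  "degree E v = card {w. {v, w} \<in> E}"

definition simple_graph :: "'v set set \<Rightarrow> bool" where
  "simple_graph E \<longleftrightarrow> (\<forall>e\<in>E. card e = 2)"

definition connected_graph :: "'v set set \<Rightarrow> bool" where
  "connected_graph E \<longleftrightarrow> (\<forall>v w. (v, w) \<in> (adj_rel E)\<^sup>*)"

definition no_isolated_vertices :: "'v set set \<Rightarrow> bool" where
  "no_isolated_vertices E \<longleftrightarrow> (\<forall>v. \<exists>w. {v, w} \<in> E)"

text \<open>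
  An orientation sends each edge to the ordered pair (input, output) of its endpoints; its values
  outside \<open>E\<close> are irrelevant.
\<close>

definition orientation :: "'v set set \<Rightarrow> ('v set \<Rightarrow> 'v \<times> 'v) \<Rightarrow> bool" where
  "orientation E ori \<longleftrightarrow> (\<forall>e\<in>E. e = {fst (ori e), snd (ori e)})"

definition adjacency_matrix :: "'v::finite set set \<Rightarrow> real ^ 'v ^ 'v" where
  "adjacency_matrix E = (\<chi> v w. if {v, w} \<in> E then 1 else 0)"

definition degree_matrix :: "'v::finite set set \<Rightarrow> real ^ 'v ^ 'v" where
  "degree_matrix E = (\<chi> v w. if v = w then real (degree E v) else 0)"

definition normalized_laplacian :: "'v::finite set set \<Rightarrow> real ^ 'v ^ 'v" where
  "normalized_laplacian E = mat 1 - matrix_inv (degree_matrix E) ** adjacency_matrix E"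

definition eigenvalues :: "real ^ 'v ^ 'v::finite \<Rightarrow> real set" where
  "eigenvalues M = {c. \<exists>x. x \<noteq> 0 \<and> M *v x = c *\<^sub>R x}"

definition largest_eigenvalue :: "real ^ 'v ^ 'v::finite \<Rightarrow> real" where
  "largest_eigenvalue M = Max (eigenvalues M)"

definition Q :: "'v::finite set set \<Rightarrow> real" where
  "Q E = Max {1 / real (degree E v) + 1 / real (degree E w) | v w. {v, w} \<in> E}"

definition \<tau> :: "'v::finite set set \<Rightarrow> real" where
  "\<tau> E = Max {(real (degree E w) - real (degree E v) + real CARD('v)) * real (degree E v)
                / (real (degree E v) + real (degree E w)) | v w.
              {v, w} \<in> E \<and> degree E w \<ge> degree E v}"

definition edge_quotient ::
    "'v::finite set set \<Rightarrow> ('v set \<Rightarrow> 'v \<times> 'v) \<Rightarrow> ('v set \<Rightarrow> real) \<Rightarrow> real" where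
  "edge_quotient E ori \<gamma> =
    (\<Sum>v\<in>UNIV. 1 / real (degree E v) *
        \<bar>(\<Sum>e | e \<in> E \<and> fst (ori e) = v. \<gamma> e) - (\<Sum>e | e \<in> E \<and> snd (ori e) = v. \<gamma> e)\<bar>)
    / (\<Sum>e\<in>E. \<bar>\<gamma> e\<bar>)"

text \<open>
  \<open>Max\<close> is unspecified on infinite sets, so a maximum over a possibly infinite set is expressed by
  a predicate that includes its attainment.
\<close>

definition is_maximum :: "real set \<Rightarrow> real \<Rightarrow> bool" where
  "is_maximum S m \<longleftrightarrow> m \<in> S \<and> (\<forall>x\<in>S. x \<le> m)"

end

theory Submission
  imports Defs
begin

text \<open>
  For the first claim, exchanging the order of summation shows that the quotient is at most \<open>Q\<close>, and
  the indicator function of an edge attaining \<open>Q\<close> gives equality.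

  The eigenvalues of \<open>L\<close> are those of the pencil \<open>(D - A) x = c D x\<close>, whose largest one is the maximum
  of a Rayleigh quotient. Evaluating it at the vector with entries \<open>1 / deg v\<close> at \<open>v\<close> and
  \<open>- 1 / deg w\<close> at \<open>w\<close> gives \<open>1 + 2 / (deg v + deg w) \<ge> 1 / deg v + 1 / deg w\<close>.

  For the upper bound, take an eigenfunction \<open>x\<close> and an edge \<open>{v, w}\<close> on which \<open>x v - x w\<close> is
  maximal, and subtract the eigenvalue equations at \<open>v\<close> and \<open>w\<close>. If \<open>v\<close> and \<open>w\<close> have \<open>c\<close> common
  neighbours, this yields \<open>\<lambda> \<le> 2 - c / max (deg v) (deg w)\<close>; conclude with \<open>c \<ge> deg v + deg w - n\<close>.
\<close>

section \<open>Symmetric pencils\<close>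

text \<open>Moving from \<open>x\<close> along \<open>g = C *v x\<close> changes the form by
  \<open>2 * t * (g \<bullet> g)\<close> to first order, so a small negative \<open>t\<close> would
  make it negative unless \<open>g = 0\<close>.\<close>

lemma positive_semidefinite_null_vector:
  fixes C :: "real ^ 'n ^ 'n::finite"
  assumes sym: "transpose C = C"
    and psd: "\<And>y. 0 \<le> y \<bullet> (C *v y)"
    and zero: "x \<bullet> (C *v x) = 0"
  shows "C *v x = 0"
proof (rule ccontr)
  assume "C *v x \<noteq> 0"
  define g where "g = C *v x"
  have g: "0 < g \<bullet> g" using \<open>C *v x \<noteq> 0\<close> by (simp add: g_def)
  have ineq: "0 \<le> 2 * t * (g \<bullet> g) + t\<^sup>2 * (g \<bullet> (C *v g))" for t :: real
  proof -
    have "x \<bullet> g = 0" using zero by (simp add: g_def)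
    moreover have "x \<bullet> (C *v g) = g \<bullet> g"
      by (metis dot_lmul_matrix g_def sym transpose_matrix_vector)
    ultimately have "(x + t *\<^sub>R g) \<bullet> (C *v (x + t *\<^sub>R g)) = 2 * t * (g \<bullet> g) + t\<^sup>2 * (g \<bullet> (C *v g))"
      by (simp add: matrix_vector_right_distrib inner_add_left inner_add_right
          matrix_vector_mult_scaleR power2_eq_square distrib_left mult.assoc inner_commute[of g x]
          flip: g_def)
    then show ?thesis using psd[of "x + t *\<^sub>R g"] by simp
  qed
  define h where "h = g \<bullet> (C *v g)"
  have h: "0 \<le> h" unfolding h_def by (rule psd)
  \<comment> \<open>The denominator \<open>h + 1\<close> is positive even when \<open>h = 0\<close>,
    and it makes \<open>t\<close> small enough that \<open>- (t * h)\<close> is at most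
    \<open>g \<bullet> g\<close>, so the linear term dominates.\<close>
  define t where "t = - (g \<bullet> g) / (h + 1)"
  have "t < 0" using g h by (simp add: t_def divide_neg_pos)
  moreover have "- (t * h) \<le> g \<bullet> g" using g h by (simp add: t_def pos_divide_le_eq)
  then have "0 < 2 * (g \<bullet> g) + t * h" using g by linarith
  ultimately have "t * (2 * (g \<bullet> g) + t * h) < 0" by (rule mult_neg_pos)
  then show False using ineq[of t] by (simp add: h_def algebra_simps power2_eq_square)
qed

text \<open>By compactness the quotient of the two quadratic forms attains its maximum
  \<open>m\<close> on the unit sphere. Then \<open>m\<close> times the diagonal form minus
  \<open>B\<close> is positive semidefinite and vanishes at the maximizer, which therefore lies in
  its kernel. One \<open>m\<close> thus serves both as an eigenvalue and as the variational
  bound.\<close>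

lemma pencil_rayleigh_max:
  fixes B :: "real ^ 'n ^ 'n::finite" and d :: "'n \<Rightarrow> real"
  assumes sym: "transpose B = B" and pos: "\<And>i. 0 < d i"
  obtains m x where "x \<noteq> 0" "\<And>i. (B *v x) $ i = m * d i * x $ i"
    "\<And>y. y \<bullet> (B *v y) \<le> m * (\<Sum>i\<in>UNIV. d i * (y $ i)\<^sup>2)"
proof -
  define S :: "(real ^ 'n) set" where "S = sphere 0 1"
  define w where "w y = (\<Sum>i\<in>UNIV. d i * (y $ i)\<^sup>2)" for y :: "real ^ 'n"
  have wpos: "0 < w y" if y: "y \<noteq> 0" for y
  proof -
    obtain i where "y $ i \<noteq> 0" using y by (metis vec_eq_iff zero_index)
    then show ?thesis unfolding w_def using pos
      by (intro sum_pos2[of _ i]) (auto simp: less_imp_le)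
  qed
  define R where "R y = (y \<bullet> (B *v y)) / w y" for y
  have "axis undefined 1 \<in> S" by (simp add: S_def)
  then have "S \<noteq> {}" by blast
  moreover have "continuous_on S R"
    unfolding R_def
  proof (intro continuous_on_divide)
    show "continuous_on S (\<lambda>y. y \<bullet> (B *v y))"
      by (intro continuous_on_inner continuous_on_id linear_continuous_on
          matrix_vector_mul_bounded_linear)
    show "continuous_on S w"
      unfolding w_def by (intro continuous_intros)
    show "\<forall>y\<in>S. w y \<noteq> 0" using wpos by (metis S_def less_irrefl norm_zero dist_0_norm mem_sphere zero_neq_one)
  qed
  ultimately obtain x where x: "x \<in> S" "\<And>y. y \<in> S \<Longrightarrow> R y \<le> R x"
    using continuous_attains_sup[of S R] by (auto simp: S_def)
  define m where "m = R x"
  have x0: "x \<noteq> 0" using x(1) by (auto simp: S_def)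
  \<comment> \<open>The quotient \<open>R\<close> is invariant under scaling, so the bound on the
    sphere extends to every nonzero vector.\<close>
  have bound: "y \<bullet> (B *v y) \<le> m * w y" for y
  proof (cases "y = 0")
    case True
    then show ?thesis by (simp add: w_def)
  next
    case False
    define z where "z = (1 / norm y) *\<^sub>R y"
    have "z \<in> S" using False by (simp add: S_def z_def)
    then have "R z \<le> m" using x(2) by (simp add: m_def)
    moreover have "R z = R y"
    proof -
      have "w z = (1 / norm y)\<^sup>2 * w y"
        by (simp add: w_def z_def sum_distrib_left power_divide)
      moreover have "z \<bullet> (B *v z) = (1 / norm y)\<^sup>2 * (y \<bullet> (B *v y))"
        by (simp add: z_def matrix_vector_mult_scaleR power2_eq_square)
      ultimately show ?thesis using False by (simp add: R_def)
    qed
    ultimately have "(y \<bullet> (B *v y)) / w y \<le> m" by (simp add: R_def)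
    then show ?thesis using wpos[OF False] by (simp add: pos_divide_le_eq)
  qed
  define C where "C = (\<chi> i j. m * (if i = j then d i else 0)) - B"
  have Cv: "(C *v y) $ i = m * d i * y $ i - (B *v y) $ i" for y i
  proof -
    have "(\<Sum>j\<in>UNIV. m * (if i = j then d i else 0) * y $ j)
      = (\<Sum>j\<in>UNIV. if i = j then m * d i * y $ j else 0)"
      by (intro sum.cong) auto
    then show ?thesis
      by (simp add: C_def matrix_vector_mult_diff_rdistrib) (simp add: matrix_vector_mult_def)
  qed
  have Cq: "y \<bullet> (C *v y) = m * w y - y \<bullet> (B *v y)" for y
    by (simp add: inner_vec_def Cv w_def sum_distrib_left sum_subtractf algebra_simps
        power2_eq_square)
  have "C *v x = 0"
  proof (rule positive_semidefinite_null_vector)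
    have "B $ j $ i = B $ i $ j" for i j
      using sym by (metis transpose_def vec_lambda_beta)
    then show "transpose C = C" by (simp add: C_def transpose_def vec_eq_iff)
    show "0 \<le> y \<bullet> (C *v y)" for y using bound Cq by simp
    show "x \<bullet> (C *v x) = 0" using wpos[OF x0] by (simp add: Cq m_def R_def)
  qed
  then have "(B *v x) $ i = m * d i * x $ i" for i
    using Cv[of x i] by simp
  then show ?thesis using that[of x m] x0 bound by (simp add: w_def)
qed

text \<open>Eigenvectors for different eigenvalues are orthogonal in the inner product weighted by
  \<open>d\<close>, and nonzero pairwise orthogonal vectors are linearly independent. Finiteness is
  what gives \<open>Max\<close> over the eigenvalues a meaning.\<close>

lemma finite_pencil_eigenvalues:
  fixes B :: "real ^ 'n ^ 'n::finite" and d :: "'n \<Rightarrow> real"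
  assumes sym: "transpose B = B" and pos: "\<And>i. 0 < d i"
  shows "finite {c. \<exists>x. x \<noteq> 0 \<and> (\<forall>i. (B *v x) $ i = c * d i * x $ i)}"
proof -
  define P where "P c x \<longleftrightarrow> x \<noteq> 0 \<and> (\<forall>i. (B *v x) $ i = c * d i * x $ i)" for c x
  define S where "S = {c. \<exists>x. P c x}"
  define X where "X c = (SOME x. P c x)" for c
  have X: "P c (X c)" if "c \<in> S" for c
  proof -
    have "\<exists>x. P c x" using that by (simp add: S_def)
    then show ?thesis unfolding X_def by (rule someI_ex)
  qed
  \<comment> \<open>Rescaling by \<open>sqrt (d i)\<close> turns the weighted inner product into the
    standard one.\<close>
  define Y where "Y c = (\<chi> i. sqrt (d i) * X c $ i)" for c
  have Y0: "Y c \<noteq> 0" if c: "c \<in> S" for c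
  proof -
    obtain i where "X c $ i \<noteq> 0" using X[OF c] by (metis P_def vec_eq_iff zero_index)
    then have "Y c $ i \<noteq> 0" using pos[of i] by (simp add: Y_def)
    then show ?thesis by auto
  qed
  have orth: "Y a \<bullet> Y b = 0" if ab: "a \<in> S" "b \<in> S" "a \<noteq> b" for a b
  proof -
    have YY: "Y a \<bullet> Y b = (\<Sum>i\<in>UNIV. d i * X a $ i * X b $ i)"
      unfolding inner_vec_def Y_def
    proof (intro sum.cong refl)
      fix i
      have "sqrt (d i) * sqrt (d i) = d i" using pos[of i] by simp
      then show "(\<chi> i. sqrt (d i) * X a $ i) $ i \<bullet> (\<chi> i. sqrt (d i) * X b $ i) $ i
        = d i * X a $ i * X b $ i" by (simp add: algebra_simps)
    qed
    have "X b \<bullet> (B *v X a) = a * (Y a \<bullet> Y b)"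
      unfolding YY using X[OF ab(1)] by (simp add: P_def inner_vec_def sum_distrib_left mult_ac)
    moreover have "X a \<bullet> (B *v X b) = b * (Y a \<bullet> Y b)"
      unfolding YY using X[OF ab(2)] by (simp add: P_def inner_vec_def sum_distrib_left mult_ac)
    \<comment> \<open>Symmetry of \<open>B\<close> equates the two evaluations, giving
      \<open>(a - b) * (Y a \<bullet> Y b) = 0\<close>.\<close>
    moreover have "X b \<bullet> (B *v X a) = X a \<bullet> (B *v X b)"
      by (metis dot_lmul_matrix inner_commute sym transpose_matrix_vector)
    ultimately show ?thesis using ab(3) by simp
  qed
  \<comment> \<open>A vector shared by two distinct eigenvalues would be orthogonal to itself, hence
    zero.\<close>
  have inj: "inj_on Y S"
  proof (rule inj_onI)
    fix a b assume "a \<in> S" "b \<in> S" "Y a = Y b"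
    then show "a = b" using orth[of a b] Y0[of a] by auto
  qed
  have "pairwise orthogonal (Y ` S)"
    unfolding pairwise_def orthogonal_def using orth by blast
  moreover have "0 \<notin> Y ` S" using Y0 by auto
  ultimately have "finite (Y ` S)"
    by (intro independent_imp_finite pairwise_orthogonal_independent)
  then have "finite S" using inj by (rule finite_imageD)
  then show ?thesis by (simp add: S_def P_def)
qed

section \<open>The normalized Laplacian\<close>

definition nbrs :: "'v set set \<Rightarrow> 'v \<Rightarrow> 'v set" where
  "nbrs E v = {w. {v, w} \<in> E}"

lemma degree_eq_card_nbrs: "degree E v = card (nbrs E v)"
  by (simp add: degree_def nbrs_def)

lemma simple_graph_irrefl: "simple_graph E \<Longrightarrow> {v, w} \<in> E \<Longrightarrow> v \<noteq> w"
  by (auto simp: simple_graph_def)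

lemma degree_pos:
  fixes E :: "'v::finite set set"
  assumes "no_isolated_vertices E"
  shows "0 < degree E v"
proof -
  have "{w. {v, w} \<in> E} \<noteq> {}" using assms by (auto simp: no_isolated_vertices_def)
  then show ?thesis by (simp add: degree_def card_gt_0_iff)
qed

lemma degree_matrix_mult_vec:
  fixes E :: "'v::finite set set"
  shows "(degree_matrix E *v x) $ v = real (degree E v) * x $ v"
proof -
  have "(\<Sum>w\<in>UNIV. (if v = w then real (degree E v) else 0) * x $ w)
      = (\<Sum>w\<in>UNIV. if v = w then real (degree E v) * x $ w else 0)"
    by (intro sum.cong) auto
  then show ?thesis by (simp add: degree_matrix_def matrix_vector_mult_def)
qed

text \<open>The diagonal term is spread as one copy of \<open>x $ v\<close> per neighbour. This
  difference form is the one used to compare values across edges.\<close>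

lemma laplacian_mult_vec:
  fixes E :: "'v::finite set set"
  shows "((degree_matrix E - adjacency_matrix E) *v x) $ v = (\<Sum>w\<in>nbrs E v. x $ v - x $ w)"
proof -
  have "(\<Sum>w\<in>UNIV. (if {v, w} \<in> E then 1 else 0) * x $ w) = (\<Sum>w\<in>nbrs E v. x $ w)"
    by (simp add: nbrs_def if_distrib[of "\<lambda>t. t * _"] sum.If_cases cong: if_cong)
  then have "(adjacency_matrix E *v x) $ v = (\<Sum>w\<in>nbrs E v. x $ w)"
    by (simp add: adjacency_matrix_def matrix_vector_mult_def)
  then show ?thesis
    by (simp add: matrix_vector_mult_diff_rdistrib degree_matrix_mult_vec sum_subtractf degree_eq_card_nbrs)
qed

lemma transpose_laplacian:
  "transpose (degree_matrix E - adjacency_matrix E) = degree_matrix E - adjacency_matrix E"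
  by (simp add: transpose_def degree_matrix_def adjacency_matrix_def vec_eq_iff insert_commute)

text \<open>\<open>matrix_inv\<close> is defined by choice, so its two equations become available
  once some inverse is exhibited, here the diagonal matrix of reciprocal degrees.\<close>

lemma matrix_inv_degree_matrix:
  fixes E :: "'v::finite set set"
  assumes "no_isolated_vertices E"
  shows "matrix_inv (degree_matrix E) ** degree_matrix E = mat 1"
    "degree_matrix E ** matrix_inv (degree_matrix E) = mat 1"
proof -
  define F :: "real ^ 'v ^ 'v" where
    "F = (\<chi> v w. if v = w then 1 / real (degree E v) else 0)"
  have "real (degree E v) \<noteq> 0" for v using degree_pos[OF assms, of v] by simp
  then have "degree_matrix E ** F = mat 1"
    by (simp add: vec_eq_iff degree_matrix_def F_def matrix_matrix_mult_def mat_def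
        if_distrib[of "\<lambda>t. t * _"] cong: if_cong)
  then have "invertible (degree_matrix E)"
    using invertible_right_inverse by blast
  then have "degree_matrix E ** matrix_inv (degree_matrix E) = mat 1 \<and>
      matrix_inv (degree_matrix E) ** degree_matrix E = mat 1"
    unfolding invertible_def matrix_inv_def by (rule someI_ex)
  then show "matrix_inv (degree_matrix E) ** degree_matrix E = mat 1"
    "degree_matrix E ** matrix_inv (degree_matrix E) = mat 1" by simp_all
qed

text \<open>Multiplying the eigenvalue equation by the invertible degree matrix trades
  \<open>L\<close>, which need not be symmetric, for the symmetric \<open>D - A\<close> with the
  degrees as weights.\<close>

lemma eigenvalues_normalized_laplacian:
  fixes E :: "'v::finite set set"
  assumes "no_isolated_vertices E"
  shows "eigenvalues (normalized_laplacian E) = {c. \<exists>x. x \<noteq> 0 \<and>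
    (\<forall>v. ((degree_matrix E - adjacency_matrix E) *v x) $ v = c * real (degree E v) * x $ v)}"
proof -
  let ?D = "degree_matrix E" and ?A = "adjacency_matrix E"
  note inv = matrix_inv_degree_matrix[OF assms]
  have DL: "?D *v (normalized_laplacian E *v x) = (?D - ?A) *v x" for x
    by (simp add: normalized_laplacian_def matrix_vector_mult_diff_distrib
        matrix_vector_mult_diff_rdistrib matrix_vector_mul_assoc matrix_mul_assoc inv)
  have "normalized_laplacian E *v x = c *\<^sub>R x \<longleftrightarrow>
    (\<forall>v. ((?D - ?A) *v x) $ v = c * real (degree E v) * x $ v)" for c x
  proof -
    have "normalized_laplacian E *v x = c *\<^sub>R x \<longleftrightarrow>
        ?D *v (normalized_laplacian E *v x) = ?D *v (c *\<^sub>R x)"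
      by (metis inv(1) matrix_vector_mul_assoc matrix_vector_mul_lid)
    also have "\<dots> \<longleftrightarrow> (?D - ?A) *v x = ?D *v (c *\<^sub>R x)"
      by (simp only: DL)
    also have "\<dots> \<longleftrightarrow> (\<forall>v. ((?D - ?A) *v x) $ v = c * real (degree E v) * x $ v)"
      unfolding vec_eq_iff degree_matrix_mult_vec by (simp add: mult_ac)
    finally show ?thesis .
  qed
  then show ?thesis by (simp add: eigenvalues_def)
qed

lemma finite_eigenvalues_normalized_laplacian:
  fixes E :: "'v::finite set set"
  assumes "no_isolated_vertices E"
  shows "finite (eigenvalues (normalized_laplacian E))"
  unfolding eigenvalues_normalized_laplacian[OF assms]
  using finite_pencil_eigenvalues[OF transpose_laplacian[of E], of "\<lambda>v. real (degree E v)"]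
    degree_pos[OF assms] by simp

text \<open>The Rayleigh maximum \<open>m\<close> is an eigenvalue, hence at most the largest one.
  Since the weighted square sum is nonnegative, the bound with \<open>m\<close> passes to the
  largest eigenvalue.\<close>

lemma largest_eigenvalue_normalized_laplacian:
  fixes E :: "'v::finite set set"
  assumes "no_isolated_vertices E"
  shows "largest_eigenvalue (normalized_laplacian E) \<in> eigenvalues (normalized_laplacian E)"
    and "y \<bullet> ((degree_matrix E - adjacency_matrix E) *v y)
      \<le> largest_eigenvalue (normalized_laplacian E) * (\<Sum>v\<in>UNIV. real (degree E v) * (y $ v)\<^sup>2)"
proof -
  have pos: "0 < real (degree E v)" for v using degree_pos[OF assms, of v] by simp
  obtain m x where mx: "x \<noteq> 0"
      "\<And>v. ((degree_matrix E - adjacency_matrix E) *v x) $ v = m * real (degree E v) * x $ v"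
      "\<And>y. y \<bullet> ((degree_matrix E - adjacency_matrix E) *v y)
        \<le> m * (\<Sum>v\<in>UNIV. real (degree E v) * (y $ v)\<^sup>2)"
    by (rule pencil_rayleigh_max[OF transpose_laplacian[of E], of "\<lambda>v. real (degree E v)", OF pos])
       (rule that)
  have m: "m \<in> eigenvalues (normalized_laplacian E)"
    using mx(1,2) by (auto simp: eigenvalues_normalized_laplacian[OF assms])
  note fin = finite_eigenvalues_normalized_laplacian[OF assms]
  show "largest_eigenvalue (normalized_laplacian E) \<in> eigenvalues (normalized_laplacian E)"
    unfolding largest_eigenvalue_def using fin m by (intro Max_in) auto
  have "m \<le> largest_eigenvalue (normalized_laplacian E)"
    unfolding largest_eigenvalue_def using fin m by simp
  moreover have "0 \<le> (\<Sum>v\<in>UNIV. real (degree E v) * (y $ v)\<^sup>2)" by (simp add: sum_nonneg)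
  ultimately show "y \<bullet> ((degree_matrix E - adjacency_matrix E) *v y)
      \<le> largest_eigenvalue (normalized_laplacian E) * (\<Sum>v\<in>UNIV. real (degree E v) * (y $ v)\<^sup>2)"
    using mx(3)[of y] by (meson mult_right_mono order_trans)
qed

section \<open>The constants \<open>Q\<close> and \<open>\<tau>\<close>\<close>

lemma finite_setcompr2:
  fixes f :: "'v::finite \<Rightarrow> 'w::finite \<Rightarrow> 'b"
  shows "finite {f v w | v w. P v w}"
proof (rule finite_subset)
  show "{f v w | v w. P v w} \<subseteq> (\<Union>v. \<Union>w. {f v w})" by blast
qed simp

lemma Q_ge:
  fixes E :: "'v::finite set set"
  assumes "{v, w} \<in> E"
  shows "1 / real (degree E v) + 1 / real (degree E w) \<le> Q E"
  unfolding Q_def using assms by (intro Max_ge[OF finite_setcompr2] CollectI exI conjI) (rule refl)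

lemma Q_attained:
  fixes E :: "'v::finite set set"
  assumes "no_isolated_vertices E"
  obtains v w where "{v, w} \<in> E" "Q E = 1 / real (degree E v) + 1 / real (degree E w)"
proof -
  have "Q E \<in> {1 / real (degree E v) + 1 / real (degree E w) | v w. {v, w} \<in> E}"
    unfolding Q_def using assms
    by (intro Max_in[OF finite_setcompr2]) (auto simp: no_isolated_vertices_def)
  then show ?thesis by (elim CollectE exE conjE) (rule that)
qed

lemma tau_ge:
  fixes E :: "'v::finite set set"
  assumes "{v, w} \<in> E" "degree E v \<le> degree E w"
  shows "(real (degree E w) - real (degree E v) + real CARD('v)) * real (degree E v)
    / (real (degree E v) + real (degree E w)) \<le> \<tau> E"
  unfolding \<tau>_def using assms by (intro Max_ge[OF finite_setcompr2] CollectI exI conjI) (rule refl)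

lemma Q_pos:
  fixes E :: "'v::finite set set"
  assumes "no_isolated_vertices E"
  shows "0 < Q E"
proof -
  obtain v w where "Q E = 1 / real (degree E v) + 1 / real (degree E w)"
    using Q_attained[OF assms] by blast
  then show ?thesis using degree_pos[OF assms, of v] degree_pos[OF assms, of w]
    by (simp add: add_pos_pos)
qed

section \<open>The edge quotient\<close>

lemma orientation_props:
  assumes "orientation E ori" "e \<in> E"
  shows "{fst (ori e), snd (ori e)} = e" "{fst (ori e), snd (ori e)} \<in> E"
  using assms by (auto simp: orientation_def)

lemma edge_quotient_le_Q:
  fixes E :: "'v::finite set set"
  assumes ori: "orientation E ori" and nz: "\<exists>e\<in>E. \<gamma> e \<noteq> 0"
  shows "edge_quotient E ori \<gamma> \<le> Q E"
proof -
  let ?d = "\<lambda>v. real (degree E v)"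
  have pos: "0 < (\<Sum>e\<in>E. \<bar>\<gamma> e\<bar>)"
    using nz by (auto intro: sum_pos2)
  \<comment> \<open>Every edge lies in exactly one fibre of \<open>f\<close>; this is applied with
    \<open>f\<close> taking an edge to its input and to its output.\<close>
  have group: "(\<Sum>v\<in>UNIV. \<Sum>e | e \<in> E \<and> f e = v. \<bar>\<gamma> e\<bar> / ?d v) = (\<Sum>e\<in>E. \<bar>\<gamma> e\<bar> / ?d (f e))"
    for f :: "'v set \<Rightarrow> 'v"
  proof -
    have "(\<Sum>v\<in>UNIV. \<Sum>e | e \<in> E \<and> f e = v. \<bar>\<gamma> e\<bar> / ?d v)
        = (\<Sum>v\<in>UNIV. \<Sum>e | e \<in> E \<and> f e = v. \<bar>\<gamma> e\<bar> / ?d (f e))"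
      by (intro sum.cong) auto
    also have "\<dots> = (\<Sum>e\<in>E. \<bar>\<gamma> e\<bar> / ?d (f e))" by (intro sum.group) auto
    finally show ?thesis .
  qed
  have "(\<Sum>v\<in>UNIV. 1 / ?d v *
        \<bar>(\<Sum>e | e \<in> E \<and> fst (ori e) = v. \<gamma> e) - (\<Sum>e | e \<in> E \<and> snd (ori e) = v. \<gamma> e)\<bar>)
      \<le> (\<Sum>v\<in>UNIV. 1 / ?d v * ((\<Sum>e | e \<in> E \<and> fst (ori e) = v. \<bar>\<gamma> e\<bar>)
          + (\<Sum>e | e \<in> E \<and> snd (ori e) = v. \<bar>\<gamma> e\<bar>)))"
    by (intro sum_mono mult_left_mono order_trans[OF abs_triangle_ineq4] add_mono sum_abs) auto
  also have "\<dots> = (\<Sum>v\<in>UNIV. \<Sum>e | e \<in> E \<and> fst (ori e) = v. \<bar>\<gamma> e\<bar> / ?d v)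
      + (\<Sum>v\<in>UNIV. \<Sum>e | e \<in> E \<and> snd (ori e) = v. \<bar>\<gamma> e\<bar> / ?d v)"
    by (simp add: sum.distrib add_divide_distrib sum_divide_distrib)
  also have "\<dots> = (\<Sum>e\<in>E. \<bar>\<gamma> e\<bar> * (1 / ?d (fst (ori e)) + 1 / ?d (snd (ori e))))"
    by (simp add: group sum.distrib distrib_left)
  also have "\<dots> \<le> (\<Sum>e\<in>E. \<bar>\<gamma> e\<bar> * Q E)"
    using orientation_props(2)[OF ori] by (intro sum_mono mult_left_mono Q_ge) auto
  also have "\<dots> = Q E * (\<Sum>e\<in>E. \<bar>\<gamma> e\<bar>)" by (simp add: sum_distrib_left mult.commute)
  finally show ?thesis using pos by (simp add: edge_quotient_def divide_le_eq)
qed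

text \<open>Only the two endpoints contribute, with values 1 and -1 inside the absolute value. They
  are distinct, so nothing cancels.\<close>

lemma edge_quotient_indicator:
  fixes E :: "'v::finite set set"
  assumes simple: "simple_graph E" and ori: "orientation E ori" and e: "e \<in> E"
  shows "edge_quotient E ori (\<lambda>e'. if e' = e then 1 else 0)
    = 1 / real (degree E (fst (ori e))) + 1 / real (degree E (snd (ori e)))"
proof -
  define a where "a = fst (ori e)"
  define b where "b = snd (ori e)"
  have ab: "a \<noteq> b"
    using simple_graph_irrefl[OF simple orientation_props(2)[OF ori e]] by (simp add: a_def b_def)
  have ind: "(\<Sum>e' | e' \<in> E \<and> f e' = v. if e' = e then 1 else 0 :: real)
      = (if f e = v then 1 else 0)" for f :: "'v set \<Rightarrow> 'v" and v
    using e by (subst sum.delta) auto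
  have "(\<Sum>v\<in>UNIV. 1 / real (degree E v) * \<bar>(if a = v then 1 else 0) - (if b = v then 1 else 0)\<bar>)
      = (\<Sum>v\<in>UNIV. (if a = v then 1 / real (degree E v) else 0)
          + (if b = v then 1 / real (degree E v) else 0))"
    using ab by (intro sum.cong) auto
  also have "\<dots> = 1 / real (degree E a) + 1 / real (degree E b)"
    by (simp add: sum.distrib)
  moreover have "(\<Sum>e'\<in>E. \<bar>if e' = e then 1 else 0 :: real\<bar>) = 1"
    using e by (simp add: if_distrib[of abs] cong: if_cong)
  ultimately show ?thesis
    by (simp add: edge_quotient_def ind flip: a_def b_def)
qed

lemma is_maximum_edge_quotient:
  fixes E :: "'v::finite set set"
  assumes simple: "simple_graph E" and iso: "no_isolated_vertices E" and ori: "orientation E ori"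
  shows "is_maximum {edge_quotient E ori \<gamma> | \<gamma>. \<exists>e\<in>E. \<gamma> e \<noteq> 0} (Q E)"
proof -
  obtain v w where vw: "{v, w} \<in> E" "Q E = 1 / real (degree E v) + 1 / real (degree E w)"
    using Q_attained[OF iso] by blast
  define e where "e = {v, w}"
  have e: "e \<in> E" using vw by (simp add: e_def)
  \<comment> \<open>The orientation may list \<open>v\<close> and \<open>w\<close> in either order,
    but the sum is symmetric.\<close>
  have "Q E = 1 / real (degree E (fst (ori e))) + 1 / real (degree E (snd (ori e)))"
    using orientation_props(1)[OF ori e] vw(2) by (auto simp: e_def doubleton_eq_iff)
  also have "\<dots> = edge_quotient E ori (\<lambda>e'. if e' = e then 1 else 0)"
    by (rule edge_quotient_indicator[OF simple ori e, symmetric])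
  finally have "Q E \<in> {edge_quotient E ori \<gamma> | \<gamma>. \<exists>e\<in>E. \<gamma> e \<noteq> 0}"
    using e by force
  then show ?thesis
    using edge_quotient_le_Q[OF ori] by (auto simp: is_maximum_def)
qed

section \<open>Bounds on the largest eigenvalue\<close>

lemma Q_le_largest_eigenvalue:
  fixes E :: "'v::finite set set"
  assumes simple: "simple_graph E" and iso: "no_isolated_vertices E"
  shows "Q E \<le> largest_eigenvalue (normalized_laplacian E)"
proof -
  let ?c = "largest_eigenvalue (normalized_laplacian E)"
  obtain v w where vw: "{v, w} \<in> E" "Q E = 1 / real (degree E v) + 1 / real (degree E w)"
    using Q_attained[OF iso] by blast
  have neq: "v \<noteq> w" using simple_graph_irrefl[OF simple vw(1)] .
  define a where "a = real (degree E v)"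
  define b where "b = real (degree E w)"
  have ab: "1 \<le> a" "1 \<le> b"
    using degree_pos[OF iso, of v] degree_pos[OF iso, of w] by (auto simp: a_def b_def)
  \<comment> \<open>This is the inverse degree matrix applied to the difference of the indicator
    vectors of \<open>v\<close> and \<open>w\<close>, so its weighted square sum is exactly
    \<open>1 / a + 1 / b\<close>, the value of \<open>Q E\<close>.\<close>
  define y :: "real ^ 'v" where "y = (\<chi> u. if u = v then 1 / a else if u = w then - 1 / b else 0)"
  have supp: "(\<Sum>u\<in>UNIV. f u) = f v + f w"
    if "\<And>u. u \<noteq> v \<Longrightarrow> u \<noteq> w \<Longrightarrow> f u = 0" for f :: "'v \<Rightarrow> real"
  proof -
    have "(\<Sum>u\<in>UNIV. f u) = (\<Sum>u\<in>{v, w}. f u)"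
      using that by (intro sum.mono_neutral_right) auto
    then show ?thesis using neq by simp
  qed
  have sum_nbrs: "(\<Sum>u\<in>nbrs E z. y $ z - y $ u)
      = real (degree E z) * y $ z - (if v \<in> nbrs E z then 1 / a else 0)
        + (if w \<in> nbrs E z then 1 / b else 0)" for z
  proof -
    have "(\<Sum>u\<in>nbrs E z. y $ u) = (\<Sum>u\<in>UNIV. if u \<in> nbrs E z then y $ u else 0)"
      by (simp add: sum.If_cases)
    also have "\<dots> = (if v \<in> nbrs E z then 1 / a else 0) - (if w \<in> nbrs E z then 1 / b else 0)"
      using neq by (subst supp) (auto simp: y_def)
    finally show ?thesis by (simp add: sum_subtractf degree_eq_card_nbrs)
  qed
  have mem: "v \<notin> nbrs E v" "w \<notin> nbrs E w" "w \<in> nbrs E v" "v \<in> nbrs E w"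
    using vw(1) simple_graph_irrefl[OF simple, of v v] simple_graph_irrefl[OF simple, of w w]
    by (auto simp: nbrs_def insert_commute)
  have yv: "y $ v = 1 / a" "y $ w = - 1 / b" using neq by (auto simp: y_def)
  have y0: "y $ u = 0" if "u \<noteq> v" "u \<noteq> w" for u using that by (simp add: y_def)
  have sums: "(\<Sum>u\<in>nbrs E v. y $ v - y $ u) = 1 + 1 / b"
      "(\<Sum>u\<in>nbrs E w. y $ w - y $ u) = - 1 - 1 / a"
    unfolding sum_nbrs using ab by (simp_all add: mem yv flip: a_def b_def)
  have num: "y \<bullet> ((degree_matrix E - adjacency_matrix E) *v y) = 1 / a + 1 / b + 2 / (a * b)"
    unfolding inner_vec_def laplacian_mult_vec
    using ab by (subst supp) (simp add: y0, simp only: sums, simp add: yv field_simps)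
  have den: "(\<Sum>u\<in>UNIV. real (degree E u) * (y $ u)\<^sup>2) = 1 / a + 1 / b"
    using ab by (subst supp) (simp_all add: y0 yv power2_eq_square flip: a_def b_def)
  \<comment> \<open>After the mixed terms cancel, this says that \<open>1 / a\<close> and
    \<open>1 / b\<close> are at least their squares, which holds since degrees are at least
    1.\<close>
  have "(1 / a + 1 / b) * (1 / a + 1 / b) \<le> 1 / a + 1 / b + 2 / (a * b)"
  proof -
    define p where "p = 1 / a"
    define q where "q = 1 / b"
    have p: "0 \<le> p" "p \<le> 1" "0 \<le> q" "q \<le> 1" using ab by (auto simp: p_def q_def)
    have "p * p \<le> p" "q * q \<le> q" using p by (auto intro: mult_left_le)
    then have "(p + q) * (p + q) \<le> p + q + 2 * (p * q)" by (simp add: algebra_simps)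
    then show ?thesis by (simp add: p_def q_def)
  qed
  also have "\<dots> \<le> ?c * (1 / a + 1 / b)"
    using largest_eigenvalue_normalized_laplacian(2)[OF iso, of y] by (simp only: num den)
  finally have "(1 / a + 1 / b) \<le> ?c"
    using ab by (simp only: mult_le_cancel_right) (smt (verit) divide_pos_pos)
  then show ?thesis by (simp add: vw(2) a_def b_def)
qed

text \<open>Inclusion-exclusion, with the union bounded by the whole vertex set; it will bound the
  number of common neighbours from below.\<close>

lemma card_Int_ge:
  fixes A B :: "'v::finite set"
  shows "real (card A) + real (card B) - real CARD('v) \<le> real (card (A \<inter> B))"
  using card_Un_Int[of A B] card_mono[of UNIV "A \<union> B"] by simp

text \<open>
  At a common neighbour \<open>t\<close> the two nonnegative differences \<open>x v - x t\<close> and \<open>x t - x w\<close> add up to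
  \<open>x v - x w\<close>, so \<open>t\<close> contributes at most \<open>(x v - x w) / min (deg v) (deg w)\<close>.
\<close>

lemma maximal_edge_bound:
  fixes E :: "'v::finite set set" and x :: "'v \<Rightarrow> real"
  assumes iso: "no_isolated_vertices E"
    and edge: "{v, w} \<in> E" and pos: "x w < x v"
    and max: "\<And>s t. {s, t} \<in> E \<Longrightarrow> x s - x t \<le> x v - x w"
    and eigen: "\<And>u. (\<Sum>t\<in>nbrs E u. x u - x t) = c * real (degree E u) * x u"
  shows "c \<le> 2 - real (card (nbrs E v \<inter> nbrs E w))
    / max (real (degree E v)) (real (degree E w))"
proof -
  define a where "a = real (degree E v)"
  define b where "b = real (degree E w)"
  have ab: "0 < a" "0 < b"
    using degree_pos[OF iso, of v] degree_pos[OF iso, of w] by (auto simp: a_def b_def)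
  define M where "M = x v - x w"
  have M: "0 < M" using pos by (simp add: M_def)
  define C where "C = nbrs E v \<inter> nbrs E w"
  define k where "k = real (card C)"
  have left: "x v - x t \<le> M" if "t \<in> nbrs E v" for t
    using that max by (simp add: nbrs_def M_def)
  have right: "x t - x w \<le> M" if "t \<in> nbrs E w" for t
    using that max by (simp add: nbrs_def M_def insert_commute)
  have "(\<Sum>t\<in>nbrs E v - C. x v - x t) \<le> real (card (nbrs E v - C)) * M"
    using left by (intro sum_bounded_above) auto
  also have "real (card (nbrs E v - C)) = a - k"
    by (simp add: C_def k_def a_def degree_eq_card_nbrs card_Diff_subset card_mono)
  finally have 1: "(\<Sum>t\<in>nbrs E v - C. x v - x t) \<le> (a - k) * M" .
  have "(\<Sum>t\<in>nbrs E w - C. x t - x w) \<le> real (card (nbrs E w - C)) * M"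
    using right by (intro sum_bounded_above) auto
  also have "real (card (nbrs E w - C)) = b - k"
    by (simp add: C_def k_def b_def degree_eq_card_nbrs card_Diff_subset card_mono)
  finally have 2: "(\<Sum>t\<in>nbrs E w - C. x t - x w) \<le> (b - k) * M" .
  have 3: "(\<Sum>t\<in>C. (x v - x t) / a + (x t - x w) / b) \<le> k * (M / min a b)"
    unfolding k_def
  proof (rule sum_bounded_above)
    fix t assume t: "t \<in> C"
    \<comment> \<open>The bounds act crosswise: \<open>right\<close> gives the first inequality and
      \<open>left\<close> the second. Nonnegativity is what permits replacing both denominators by
      \<open>min a b\<close>.\<close>
    then have "0 \<le> x v - x t" "0 \<le> x t - x w"
      using left[of t] right[of t] by (auto simp: C_def M_def)
    then have "(x v - x t) / a + (x t - x w) / b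
        \<le> (x v - x t) / min a b + (x t - x w) / min a b"
      using ab by (intro add_mono divide_left_mono) auto
    also have "\<dots> = M / min a b" by (simp add: M_def add_divide_distrib[symmetric])
    finally show "(x v - x t) / a + (x t - x w) / b \<le> M / min a b" .
  qed
  have v: "(\<Sum>t\<in>nbrs E v. x v - x t) = (\<Sum>t\<in>nbrs E v - C. x v - x t) + (\<Sum>t\<in>C. x v - x t)"
    by (rule sum.subset_diff) (auto simp: C_def)
  have w: "(\<Sum>t\<in>nbrs E w. x t - x w) = (\<Sum>t\<in>nbrs E w - C. x t - x w) + (\<Sum>t\<in>C. x t - x w)"
    by (rule sum.subset_diff) (auto simp: C_def)
  have "c * x v = (\<Sum>t\<in>nbrs E v. x v - x t) / a"
    using ab by (simp add: eigen a_def)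
  moreover have "- (c * x w) = (\<Sum>t\<in>nbrs E w. x t - x w) / b"
  proof -
    have "(\<Sum>t\<in>nbrs E w. x t - x w) = - (\<Sum>t\<in>nbrs E w. x w - x t)"
      by (simp flip: sum_negf)
    then show ?thesis using ab by (simp add: eigen b_def)
  qed
  \<comment> \<open>The eigenvalue equations at \<open>v\<close> and \<open>w\<close>, each divided
    by the degree, are subtracted. Private neighbours are then bounded by \<open>M\<close> each and
    common ones by \<open>3\<close>.\<close>
  ultimately have "c * M = (\<Sum>t\<in>nbrs E v. x v - x t) / a + (\<Sum>t\<in>nbrs E w. x t - x w) / b"
    by (simp add: M_def algebra_simps)
  also have "\<dots> = (\<Sum>t\<in>nbrs E v - C. x v - x t) / a + (\<Sum>t\<in>nbrs E w - C. x t - x w) / b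
      + (\<Sum>t\<in>C. (x v - x t) / a + (x t - x w) / b)"
    unfolding v w by (simp only: add_divide_distrib sum.distrib sum_divide_distrib[symmetric] add_ac)
  also have "\<dots> \<le> (a - k) * M / a + (b - k) * M / b + k * (M / min a b)"
    using 1 2 3 ab by (intro add_mono divide_right_mono) auto
  \<comment> \<open>The terms in \<open>k\<close> combine through
    \<open>1 / a + 1 / b - 1 / min a b = 1 / max a b\<close>.\<close>
  also have "\<dots> = (2 - k / max a b) * M"
    using ab by (cases "a \<le> b") (auto simp: min_def max_def field_simps)
  finally show ?thesis using M by (simp add: C_def k_def a_def b_def)
qed

lemma largest_eigenvalue_le:
  fixes E :: "'v::finite set set"
  assumes simple: "simple_graph E" and iso: "no_isolated_vertices E"
  shows "largest_eigenvalue (normalized_laplacian E) \<le> Q E * \<tau> E"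
proof -
  define c where "c = largest_eigenvalue (normalized_laplacian E)"
  have c_pos: "0 < c"
    using Q_pos[OF iso] Q_le_largest_eigenvalue[OF simple iso] by (simp add: c_def)
  have "c \<in> eigenvalues (normalized_laplacian E)"
    unfolding c_def by (rule largest_eigenvalue_normalized_laplacian(1)[OF iso])
  then obtain x where x: "x \<noteq> 0"
      "\<And>v. (\<Sum>w\<in>nbrs E v. x $ v - x $ w) = c * real (degree E v) * x $ v"
    unfolding eigenvalues_normalized_laplacian[OF iso] laplacian_mult_vec by blast
  \<comment> \<open>Both orders of each edge occur, so \<open>S\<close> contains each difference
    together with its negative.\<close>
  define S where "S = {x $ s - x $ t | s t. {s, t} \<in> E}"
  have S: "finite S" "S \<noteq> {}"
    using iso by (auto simp: S_def no_isolated_vertices_def intro: finite_setcompr2)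
  then obtain v w where vw: "{v, w} \<in> E" "Max S = x $ v - x $ w"
    using Max_in[OF S] by (auto simp: S_def)
  have max: "x $ s - x $ t \<le> x $ v - x $ w" if "{s, t} \<in> E" for s t
    using that S(1) unfolding vw(2)[symmetric] by (intro Max_ge) (auto simp: S_def)
  \<comment> \<open>Otherwise \<open>x\<close> would be equal at the two ends of every edge; the
    left side of each eigenvalue equation would vanish, and \<open>0 < c\<close> would force
    \<open>x = 0\<close>.\<close>
  have pos: "x $ w < x $ v"
  proof (rule ccontr)
    assume "\<not> x $ w < x $ v"
    then have le: "x $ s \<le> x $ t" if "{s, t} \<in> E" for s t
      using max[OF that] by simp
    have "x $ s = 0" for s
    proof -
      have "(\<Sum>t\<in>nbrs E s. x $ s - x $ t) = 0"
      proof (intro sum.neutral ballI)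
        fix t assume "t \<in> nbrs E s"
        then have "{s, t} \<in> E" "{t, s} \<in> E" by (simp_all add: nbrs_def insert_commute)
        then show "x $ s - x $ t = 0" using le by (simp add: order_antisym)
      qed
      then show ?thesis using c_pos degree_pos[OF iso, of s] by (simp add: x(2))
    qed
    then show False using x(1) by (simp add: vec_eq_iff)
  qed
  have bound: "c \<le> 2 - real (card (nbrs E v \<inter> nbrs E w))
      / max (real (degree E v)) (real (degree E w))"
    using maximal_edge_bound[OF iso vw(1), of "($) x"] pos max x(2) by blast
  define n where "n = real CARD('v)"
  \<comment> \<open>The endpoints are renamed by degree, as in the definition of
    \<open>\<tau>\<close>, whereas \<open>v\<close> and \<open>w\<close> were ordered by the values
    of \<open>x\<close>. The maximum in \<open>bound\<close> thereby becomes
    \<open>b\<close>.\<close>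
  obtain s t where st: "{s, t} \<in> E" "degree E s \<le> degree E t" "{s, t} = {v, w}"
    using vw(1) by (metis insert_commute nle_le)
  define a where "a = real (degree E s)"
  define b where "b = real (degree E t)"
  have ab: "0 < a" "0 < b" "a \<le> b"
    using degree_pos[OF iso, of s] degree_pos[OF iso, of t] st(2) by (auto simp: a_def b_def)
  have "c \<le> 2 - real (card (nbrs E s \<inter> nbrs E t)) / b"
    using bound st(2,3) by (auto simp: b_def doubleton_eq_iff Int_commute max_def split: if_splits)
  also have "\<dots> \<le> 2 - (a + b - n) / b"
    using card_Int_ge[of "nbrs E s" "nbrs E t"] ab
    by (intro diff_mono divide_right_mono) (simp_all add: a_def b_def n_def degree_eq_card_nbrs)
  \<comment> \<open>Both sides equal \<open>(b - a + n) / b\<close>; splitting off the factor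
    \<open>1 / a + 1 / b\<close> leaves the expression maximized in \<open>\<tau>\<close>.\<close>
  also have "\<dots> = (1 / a + 1 / b) * ((b - a + n) * a / (a + b))"
  proof -
    have "1 / a + 1 / b = (a + b) / (a * b)" using ab by (simp add: field_simps)
    moreover have "a + b \<noteq> 0" using ab by simp
    ultimately have "(1 / a + 1 / b) * ((b - a + n) * a / (a + b)) = (b - a + n) / b"
      using ab by simp
    then show ?thesis using ab by (simp add: field_simps)
  qed
  \<comment> \<open>The same edge competes in both maxima, and the factors can be bounded separately
    because they are nonnegative, the second one by \<open>a \<le> b\<close>.\<close>
  also have "\<dots> \<le> Q E * \<tau> E"
  proof (rule mult_mono)
    show "1 / a + 1 / b \<le> Q E" unfolding a_def b_def by (rule Q_ge[OF st(1)])
    show "(b - a + n) * a / (a + b) \<le> \<tau> E"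
      unfolding a_def b_def n_def by (rule tau_ge[OF st(1,2)])
    show "0 \<le> Q E" using Q_pos[OF iso] by simp
    show "0 \<le> (b - a + n) * a / (a + b)" using ab by (simp add: n_def)
  qed
  finally show ?thesis by (simp add: c_def)
qed

theorem theorem3:
  fixes E :: "'v::finite set set"
    and ori :: "'v set \<Rightarrow> 'v \<times> 'v"
  assumes "simple_graph E"
    and "connected_graph E"
    and "no_isolated_vertices E"
    and "orientation E ori"
  shows "is_maximum {edge_quotient E ori \<gamma> | \<gamma>. \<exists>e\<in>E. \<gamma> e \<noteq> 0} (Q E) \<and>
    Q E \<le> largest_eigenvalue (normalized_laplacian E) \<and>
    largest_eigenvalue (normalized_laplacian E) \<le> Q E * \<tau> E"
  using assms
  by (intro conjI is_maximum_edge_quotient Q_le_largest_eigenvalue largest_eigenvalue_le)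

end
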